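(* Let $K$ be a field, let $P=K[x_1,\dots,x_n]$, and let $\mathfrak{M}=\langle x_1,\dots,x_n\rangle$. Let $Z=(z_1,\dots,z_s)$ be a tuple of distinct indeterminates in $\{x_1,\dots,x_n\}$, and let $Y=(y_1,\dots,y_{n-s})$ be such that $\{y_1,\dots,y_{n-s}\}=\{x_1,\dots,x_n\}\setminus\{z_1,\dots,z_s\}$. Let $I\subseteq\mathfrak{M}$ be a non-zero ideal of $P$ such that the set $\mathrm{GFan}_Z(I)$ is not empty. Then the map $\Gamma_Z:\ \mathrm{GFan}_Z(I)\longrightarrow\mathrm{GFan}(I\cap K[Y])$ is bijective.
   Context: A term ordering is a multiplicative total well-ordering on the terms (power products) of a polynomial ring; $\mathrm{LT}_\sigma(f)$ is the $\sigma$-largest term in the support of $f$. For a term ordering $\sigma$ and the reduced $\sigma$-Gröbner basis $G=\{g_1,\dots,g_r\}$ of an ideal $I$, the set of pairs $\overline{G}=\{(\mathrm{LT}_\sigma(g_1),g_1),\dots,(\mathrm{LT}_\sigma(g_r),g_r)\}$ is called the marked reduced $\sigma$-Gröbner basis of $I$. The Gröbner fan $\mathrm{GFan}(I)$ is the set of all distinct marked reduced $\sigma$-Gröbner bases of $I$, where $\sigma$ ranges over all term orderings. The same definition is used for ideals of $K[Y]$ with term orderings on the terms of $K[Y]$; the reduced Gröbner basis of the zero ideal is the empty set. The $Z$-restricted Gröbner fan $\mathrm{GFan}_Z(I)$ is the set of all marked reduced Gröbner bases $\overline{G}=\{(\mathrm{LT}_\sigma(g_1),g_1),\dots,(\mathrm{LT}_\sigma(g_r),g_r)\}$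 of $I$ such that for every $j=1,\dots,s$ there is an index $i_j\in\{1,\dots,r\}$ with $z_j=\mathrm{LT}_\sigma(g_{i_j})$. The $Z$-restricted GFan projection $\Gamma_Z$ is defined as follows: for $\overline{G}\in\mathrm{GFan}_Z(I)$, where $G=\{g_1,\dots,g_r\}$ is a reduced $\sigma$-Gröbner basis of $I$, one has $r\ge s$ and may number the elements such that $\mathrm{LT}_\sigma(g_i)=z_i$ for $i=1,\dots,s$; then $\Gamma_Z(\overline{G})=\{(\mathrm{LT}_\sigma(g_{s+1}),g_{s+1}),\dots,(\mathrm{LT}_\sigma(g_r),g_r)\}$. (The set $\{g_{s+1},\dots,g_r\}$ is the reduced Gröbner basis of $I\cap K[Y]$ with respect to the restriction of $\sigma$ to $K[Y]$, so the map is well-defined.) *)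

theory Defs
  imports "HOL-Library.Poly_Mapping" "HOL-Algebra.Ideal"
begin

type_synonym pp = "nat \<Rightarrow>\<^sub>0 nat"
type_synonym 'k mpoly = "pp \<Rightarrow>\<^sub>0 'k"

text \<open>
  Indeterminates are indexed by natural numbers. A power product is its exponent vector, so
  multiplication of power products is addition of exponent vectors, and a polynomial is the
  finitely supported family of its coefficients. For a set \<open>X\<close> of indeterminates,
  \<open>pps X\<close> are the power products in \<open>X\<close> and \<open>poly_ring X\<close> is the
  polynomial ring \<open>K[X]\<close>, so that \<open>K[Y]\<close> is a subring of \<open>K[X]\<close> for
  \<open>Y \<subseteq> X\<close>.
\<close>

definition pps :: "nat set \<Rightarrow> pp set"
  where "pps X = {t. Poly_Mapping.keys t \<subseteq> X}"

definition var_pp :: "nat \<Rightarrow> pp"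
  where "var_pp i = Poly_Mapping.single i 1"

definition pp_poly :: "pp \<Rightarrow> 'k::field mpoly"
  where "pp_poly t = Poly_Mapping.single t 1"

definition poly_ring :: "nat set \<Rightarrow> 'k::field mpoly ring"
  where "poly_ring X =
    \<lparr>carrier = {f. Poly_Mapping.keys f \<subseteq> pps X}, mult = (*), one = 1, zero = 0, add = (+)\<rparr>"

definition irrelevant_ideal :: "nat set \<Rightarrow> 'k::field mpoly set"
  where "irrelevant_ideal X = Idl\<^bsub>poly_ring X\<^esub> ((\<lambda>i. pp_poly (var_pp i)) ` X)"

definition term_ordering :: "nat set \<Rightarrow> pp rel \<Rightarrow> bool"
  where "term_ordering X \<sigma> \<longleftrightarrow> well_order_on (pps X) \<sigma> \<and>
    (\<forall>s t u. (s, t) \<in> \<sigma> \<and> u \<in> pps X \<longrightarrow> (s + u, t + u) \<in> \<sigma>)"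

text \<open>Only meaningful for non-zero \<open>f\<close>.\<close>

definition LT :: "pp rel \<Rightarrow> 'k::field mpoly \<Rightarrow> pp"
  where "LT \<sigma> f =
    (THE t. t \<in> Poly_Mapping.keys f \<and> (\<forall>s \<in> Poly_Mapping.keys f. (s, t) \<in> \<sigma>))"

definition LC :: "pp rel \<Rightarrow> 'k::field mpoly \<Rightarrow> 'k"
  where "LC \<sigma> f = Poly_Mapping.lookup f (LT \<sigma> f)"

definition LT_ideal :: "nat set \<Rightarrow> pp rel \<Rightarrow> 'k::field mpoly set \<Rightarrow> 'k mpoly set"
  where "LT_ideal X \<sigma> F = Idl\<^bsub>poly_ring X\<^esub> ((\<lambda>f. pp_poly (LT \<sigma> f)) ` (F - {0}))"

definition groebner_basis ::
    "nat set \<Rightarrow> pp rel \<Rightarrow> 'k::field mpoly set \<Rightarrow> 'k mpoly set \<Rightarrow> bool"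
  where "groebner_basis X \<sigma> I G \<longleftrightarrow>
    finite G \<and> G \<subseteq> I - {0} \<and> LT_ideal X \<sigma> I = LT_ideal X \<sigma> G"

definition reduced_groebner_basis ::
    "nat set \<Rightarrow> pp rel \<Rightarrow> 'k::field mpoly set \<Rightarrow> 'k mpoly set \<Rightarrow> bool"
  where "reduced_groebner_basis X \<sigma> I G \<longleftrightarrow>
    groebner_basis X \<sigma> I G \<and> (\<forall>g \<in> G. LC \<sigma> g = 1) \<and>
    (\<forall>g \<in> G. \<forall>h \<in> G - {g}. \<forall>t \<in> Poly_Mapping.keys g. \<nexists>u. t = LT \<sigma> h + u)"

definition marked :: "pp rel \<Rightarrow> 'k::field mpoly set \<Rightarrow> (pp \<times> 'k mpoly) set"
  where "marked \<sigma> G = (\<lambda>g. (LT \<sigma> g, g)) ` G"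

definition GFan :: "nat set \<Rightarrow> 'k::field mpoly set \<Rightarrow> (pp \<times> 'k mpoly) set set"
  where "GFan X I = {marked \<sigma> G | \<sigma> G. term_ordering X \<sigma> \<and> reduced_groebner_basis X \<sigma> I G}"

definition restricted_GFan ::
    "nat set \<Rightarrow> nat list \<Rightarrow> 'k::field mpoly set \<Rightarrow> (pp \<times> 'k mpoly) set set"
  where "restricted_GFan X Z I = {M \<in> GFan X I. \<forall>z \<in> set Z. \<exists>g. (var_pp z, g) \<in> M}"

text \<open>
  The marked terms of a marked reduced Groebner basis are pairwise distinct, so for each \<open>z\<close> in
  \<open>Z\<close> exactly one pair, the one marked by \<open>z\<close>, is dropped.
\<close>

definition GFan_projection ::
    "nat list \<Rightarrow> (pp \<times> 'k::field mpoly) set \<Rightarrow> (pp \<times> 'k mpoly) set"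
  where "GFan_projection Z M = {(t, g) \<in> M. t \<notin> var_pp ` set Z}"

lemma pps_add: "s \<in> pps X \<Longrightarrow> t \<in> pps X \<Longrightarrow> s + t \<in> pps X"
  using Poly_Mapping.keys_add[of s t] by (auto simp: pps_def)

lemma poly_ring_cring: "cring (poly_ring X :: 'k::field mpoly ring)"
proof (rule cringI)
  show "abelian_group (poly_ring X :: 'k mpoly ring)"
  proof (rule abelian_groupI)
    fix f g :: "'k mpoly"
    assume "f \<in> carrier (poly_ring X)" "g \<in> carrier (poly_ring X)"
    then show "f \<oplus>\<^bsub>poly_ring X\<^esub> g \<in> carrier (poly_ring X)"
      using Poly_Mapping.keys_add[of f g] by (auto simp: poly_ring_def)
  next
    fix f :: "'k mpoly"
    assume "f \<in> carrier (poly_ring X)"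
    then have "- f \<in> carrier (poly_ring X)" by (simp add: poly_ring_def)
    then show "\<exists>g \<in> carrier (poly_ring X). g \<oplus>\<^bsub>poly_ring X\<^esub> f = \<zero>\<^bsub>poly_ring X\<^esub>"
      by (rule rev_bexI) (simp add: poly_ring_def)
  qed (auto simp: poly_ring_def algebra_simps)
  show "Group.comm_monoid (poly_ring X :: 'k mpoly ring)"
  proof (rule comm_monoidI)
    fix f g :: "'k mpoly"
    assume "f \<in> carrier (poly_ring X)" "g \<in> carrier (poly_ring X)"
    then show "f \<otimes>\<^bsub>poly_ring X\<^esub> g \<in> carrier (poly_ring X)"
      using Poly_Mapping.keys_mult[of f g] by (fastforce simp: poly_ring_def intro: pps_add)
  qed (auto simp: poly_ring_def pps_def algebra_simps)
qed (auto simp: poly_ring_def algebra_simps)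

end

theory Submission
  imports Defs
begin

text \<open>
  Let \<open>X\<close> be the set of all indeterminates, \<open>Y = X - Z\<close> and \<open>J = I \<inter> K[Y]\<close>.
  If the indeterminates in \<open>Z\<close> are leading terms of a reduced Groebner basis \<open>G\<close> of \<open>I\<close>,
  then by reducedness every term of \<open>G\<close> that involves \<open>Z\<close> is such a leading term
  (\<open>reduced_basis_term\<close>). Thus \<open>G\<close> consists of polynomials \<open>z - r\<^sub>z\<close> with \<open>r\<^sub>z \<in> K[Y]\<close>,
  one for each \<open>z\<close> in \<open>Z\<close>, and of a set \<open>H \<subseteq> K[Y]\<close>.

  The projection takes values in the fan of \<open>J\<close> (\<open>GFan_projection_in_GFan\<close>): the leading term
  of an element of \<open>J\<close> involves only \<open>Y\<close>, so it can only be divisible by a leading term from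
  \<open>H\<close>, and \<open>H\<close> is the reduced Groebner basis of \<open>J\<close> for the restricted ordering.

  The projection is injective (\<open>GFan_projection_subset\<close>): if two marked bases share \<open>H\<close> with
  its marks, then their elements marked by \<open>z\<close> differ by an element of \<open>J\<close> none of whose terms
  is divisible by a mark of \<open>H\<close>. A non-zero element of \<open>J\<close> has a leading term divisible by
  such a mark, so the difference is zero.

  The projection is surjective (\<open>GFan_projection_surj\<close>): given the reduced basis \<open>H\<close> of \<open>J\<close>
  for an ordering \<open>\<tau>\<close> on \<open>K[Y]\<close>, replace each \<open>r\<^sub>z\<close> by its normal form modulo \<open>J\<close> with
  respect to \<open>\<tau>\<close> (\<open>normal_form_exists\<close>). For an ordering that eliminates \<open>Z\<close> and extends
  \<open>\<tau>\<close> (\<open>elim_ordering\<close>), the resulting polynomials together with \<open>H\<close> form the reduced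
  Groebner basis of \<open>I\<close>. An element of \<open>I\<close> whose leading term is free of \<open>Z\<close> lies in \<open>J\<close>,
  which gives the Groebner property. Reducedness needs in addition that \<open>J\<close> contains no
  non-zero constant when \<open>Z\<close> is non-empty; this holds because 1 is not a leading term of the
  given reduced basis, in which \<open>z\<close> occurs.
\<close>

section \<open>Power products\<close>

lemma keys_add_pp: "Poly_Mapping.keys (s + t) = Poly_Mapping.keys s \<union> Poly_Mapping.keys (t::pp)"
  by (auto simp: in_keys_iff lookup_add)

lemma pps_add_iff: "s + t \<in> pps X \<longleftrightarrow> s \<in> pps X \<and> t \<in> pps X"
  by (auto simp: pps_def keys_add_pp)

lemma zero_in_pps: "0 \<in> pps X"
  by (simp add: pps_def)

lemma pps_mono: "Y \<subseteq> X \<Longrightarrow> pps Y \<subseteq> pps X"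
  by (auto simp: pps_def)

lemma var_pp_in_pps_iff: "var_pp i \<in> pps X \<longleftrightarrow> i \<in> X"
  by (simp add: pps_def var_pp_def)

lemma var_pp_dvd:
  assumes "i \<in> Poly_Mapping.keys t"
  obtains u where "t = var_pp i + u"
proof
  show "t = var_pp i + (t - var_pp i)"
    using assms
    by (intro poly_mapping_eqI)
      (auto simp: lookup_add lookup_minus var_pp_def lookup_single when_def in_keys_iff)
qed

text \<open>The part of a power product that involves the indeterminates in \<open>A\<close>: all other
  exponents are set to 0.\<close>

lift_definition restrict_pp :: "nat set \<Rightarrow> pp \<Rightarrow> pp"
  is "\<lambda>A t i. if i \<in> A then t i else 0"
  by (rule finite_subset) auto

lemma restrict_pp_add: "restrict_pp A (s + t) = restrict_pp A s + restrict_pp A t"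
  by transfer auto

lemma keys_restrict_pp: "Poly_Mapping.keys (restrict_pp A t) = A \<inter> Poly_Mapping.keys t"
  by transfer auto

lemma restrict_pp_ident: "t \<in> pps A \<Longrightarrow> restrict_pp A t = t"
  by (rule poly_mapping_eqI) (auto simp: restrict_pp.rep_eq pps_def in_keys_iff)

lemma restrict_pp_eq_0_iff: "restrict_pp A t = 0 \<longleftrightarrow> A \<inter> Poly_Mapping.keys t = {}"
  by (metis keys_restrict_pp keys_eq_empty)

lemma restrict_pp_split:
  "t \<in> pps X \<Longrightarrow> restrict_pp A t + restrict_pp (X - A) t = t"
  by (rule poly_mapping_eqI) (auto simp: restrict_pp.rep_eq pps_def in_keys_iff lookup_add)


section \<open>Term orderings and leading terms\<close>

lemma term_orderingD:
  assumes "term_ordering X \<sigma>"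
  shows "\<sigma> \<subseteq> pps X \<times> pps X" "\<And>t. t \<in> pps X \<Longrightarrow> (t, t) \<in> \<sigma>" "trans \<sigma>" "antisym \<sigma>"
    "\<And>s t. s \<in> pps X \<Longrightarrow> t \<in> pps X \<Longrightarrow> (s, t) \<in> \<sigma> \<or> (t, s) \<in> \<sigma>"
    "wf (\<sigma> - Id)"
    "\<And>s t u. (s, t) \<in> \<sigma> \<Longrightarrow> u \<in> pps X \<Longrightarrow> (s + u, t + u) \<in> \<sigma>"
proof -
  have W: "\<sigma> \<subseteq> pps X \<times> pps X \<and> (\<forall>t \<in> pps X. (t, t) \<in> \<sigma>) \<and> trans \<sigma> \<and> antisym \<sigma> \<and>
    (\<forall>s \<in> pps X. \<forall>t \<in> pps X. s \<noteq> t \<longrightarrow> (s, t) \<in> \<sigma> \<or> (t, s) \<in> \<sigma>) \<and> wf (\<sigma> - Id)"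
    using assms unfolding term_ordering_def order_on_defs total_on_def refl_on_def by simp
  then show "\<sigma> \<subseteq> pps X \<times> pps X" "trans \<sigma>" "antisym \<sigma>" "wf (\<sigma> - Id)" by simp_all
  show refl: "(t, t) \<in> \<sigma>" if "t \<in> pps X" for t using W that by simp
  show "(s, t) \<in> \<sigma> \<or> (t, s) \<in> \<sigma>" if "s \<in> pps X" "t \<in> pps X" for s t
    using W that refl by (cases "s = t") simp_all
  show "(s + u, t + u) \<in> \<sigma>" if "(s, t) \<in> \<sigma>" "u \<in> pps X" for s t u
    using assms that unfolding term_ordering_def by simp
qed

lemma term_orderingI:
  assumes "\<sigma> \<subseteq> pps X \<times> pps X" "\<And>t. t \<in> pps X \<Longrightarrow> (t, t) \<in> \<sigma>" "trans \<sigma>" "antisym \<sigma>"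
    "\<And>s t. s \<in> pps X \<Longrightarrow> t \<in> pps X \<Longrightarrow> (s, t) \<in> \<sigma> \<or> (t, s) \<in> \<sigma>"
    "wf (\<sigma> - Id)"
    "\<And>s t u. (s, t) \<in> \<sigma> \<Longrightarrow> u \<in> pps X \<Longrightarrow> (s + u, t + u) \<in> \<sigma>"
  shows "term_ordering X \<sigma>"
  unfolding term_ordering_def order_on_defs total_on_def refl_on_def
  using assms by simp

text \<open>Well-foundedness makes the power product 1, which is the exponent vector 0, the least
  one.\<close>

lemma zero_least:
  assumes ord: "term_ordering X \<sigma>" and t: "t \<in> pps X"
  shows "(0, t) \<in> \<sigma>"
proof (rule ccontr)
  assume neg: "(0, t) \<notin> \<sigma>"
  then have le: "(t, 0) \<in> \<sigma>" and "t \<noteq> 0"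
    using term_orderingD(2,5)[OF ord] t zero_in_pps by blast+
  \<comment> \<open>the multiples of \<open>t\<close> descend forever\<close>
  define m where "m k = ((\<lambda>s. s + t) ^^ k) 0" for k :: nat
  have m: "m k \<in> pps X" for k
    by (induction k) (simp_all add: m_def zero_in_pps pps_add t)
  have "(m (Suc k), m k) \<in> \<sigma> - Id" for k
    using term_orderingD(7)[OF ord le m[of k]] \<open>t \<noteq> 0\<close> by (simp add: m_def add.commute)
  then show False
    using term_orderingD(6)[OF ord] unfolding wf_iff_no_infinite_down_chain by blast
qed

lemma dvd_imp_le:
  assumes "term_ordering X \<sigma>" "s \<in> pps X" "u \<in> pps X"
  shows "(s, s + u) \<in> \<sigma>"
  using term_orderingD(7)[OF assms(1) zero_least[OF assms(1,3)] assms(2)]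
  by (simp add: add.commute)

lemma term_ordering_Restr:
  assumes ord: "term_ordering X \<sigma>" and "Y \<subseteq> X"
  shows "term_ordering Y (Restr \<sigma> (pps Y))"
proof (rule term_orderingI)
  note D = term_orderingD[OF ord] and sub = pps_mono[OF \<open>Y \<subseteq> X\<close>]
  show "(t, t) \<in> Restr \<sigma> (pps Y)" if "t \<in> pps Y" for t
    using that D(2) sub by blast
  show "trans (Restr \<sigma> (pps Y))" using D(3) by (auto simp: trans_def)
  show "antisym (Restr \<sigma> (pps Y))" using D(4) by (auto simp: antisym_def)
  show "wf (Restr \<sigma> (pps Y) - Id)" by (rule wf_subset[OF D(6)]) blast
  show "(s, t) \<in> Restr \<sigma> (pps Y) \<or> (t, s) \<in> Restr \<sigma> (pps Y)"
    if "s \<in> pps Y" "t \<in> pps Y" for s t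
    using that D(5) sub by blast
  show "(s + u, t + u) \<in> Restr \<sigma> (pps Y)"
    if "(s, t) \<in> Restr \<sigma> (pps Y)" "u \<in> pps Y" for s t u
    using that D(7) sub by (auto intro: pps_add)
qed auto

lemma LT_eqI:
  assumes "term_ordering X \<sigma>" "t \<in> Poly_Mapping.keys f"
    "\<And>s. s \<in> Poly_Mapping.keys f \<Longrightarrow> (s, t) \<in> \<sigma>"
  shows "LT \<sigma> f = t"
  unfolding LT_def using assms term_orderingD(4)[OF assms(1)]
  by (intro the_equality) (auto dest: antisymD)

lemma LT_greatest:
  assumes ord: "term_ordering X \<sigma>" and "f \<noteq> 0" "Poly_Mapping.keys f \<subseteq> pps X"
  shows "LT \<sigma> f \<in> Poly_Mapping.keys f \<and> (\<forall>s \<in> Poly_Mapping.keys f. (s, LT \<sigma> f) \<in> \<sigma>)"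
proof -
  have "\<exists>t \<in> A. \<forall>s \<in> A. (s, t) \<in> \<sigma>" if "finite A" "A \<noteq> {}" "A \<subseteq> pps X" for A
    using that
  proof (induction A rule: finite_ne_induct)
    case (singleton x)
    then show ?case using term_orderingD(2)[OF ord] by auto
  next
    case (insert x A)
    then obtain t where t: "t \<in> A" "\<forall>s \<in> A. (s, t) \<in> \<sigma>" by auto
    have "(x, t) \<in> \<sigma> \<or> (t, x) \<in> \<sigma>" "(x, x) \<in> \<sigma>"
      using insert.prems t(1) term_orderingD(2,5)[OF ord] by blast+
    then show ?case
      using t term_orderingD(3)[OF ord] by (metis insert_iff transD)
  qed
  from this[OF finite_keys _ assms(3)] obtain t
    where t: "t \<in> Poly_Mapping.keys f" "\<forall>s \<in> Poly_Mapping.keys f. (s, t) \<in> \<sigma>"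
    using \<open>f \<noteq> 0\<close> by (auto simp: keys_eq_empty)
  with LT_eqI[OF ord, of t f] show ?thesis by simp
qed

lemma LT_in_pps:
  assumes "term_ordering X \<sigma>" "f \<noteq> 0" "Poly_Mapping.keys f \<subseteq> pps X"
  shows "LT \<sigma> f \<in> pps X"
  using LT_greatest[OF assms] assms(3) by blast

lemma LT_cong:
  assumes "Poly_Mapping.keys f \<subseteq> A"
    and "\<And>s t. s \<in> A \<Longrightarrow> t \<in> A \<Longrightarrow> (s, t) \<in> \<sigma> \<longleftrightarrow> (s, t) \<in> \<tau>"
  shows "LT \<sigma> f = LT \<tau> f"
proof -
  have "(t \<in> Poly_Mapping.keys f \<and> (\<forall>s \<in> Poly_Mapping.keys f. (s, t) \<in> \<sigma>)) \<longleftrightarrow>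
    (t \<in> Poly_Mapping.keys f \<and> (\<forall>s \<in> Poly_Mapping.keys f. (s, t) \<in> \<tau>))" for t
    using assms by blast
  then show ?thesis by (simp add: LT_def)
qed

lemma lookup_monomial_mult:
  "Poly_Mapping.lookup (Poly_Mapping.single u c * f) (u + t) = c * Poly_Mapping.lookup f t"
  for f :: "'k::field mpoly"
proof -
  have "Poly_Mapping.lookup (Poly_Mapping.single u c * f) (u + t) =
    (\<Sum>l. (c * (\<Sum>q. Poly_Mapping.lookup f q when u + t = l + q)) when u = l)"
    unfolding lookup_mult lookup_single by (rule Sum_any.cong) (simp add: when_def)
  then show ?thesis by simp
qed

lemma LT_monomial_mult:
  fixes f :: "'k::field mpoly"
  assumes ord: "term_ordering X \<sigma>" and f: "f \<noteq> 0" "Poly_Mapping.keys f \<subseteq> pps X"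
    and u: "u \<in> pps X" and "c \<noteq> 0"
  shows "LT \<sigma> (Poly_Mapping.single u c * f) = u + LT \<sigma> f"
    and "Poly_Mapping.single u c * f \<noteq> 0"
proof -
  have key: "u + LT \<sigma> f \<in> Poly_Mapping.keys (Poly_Mapping.single u c * f)"
    using LT_greatest[OF ord f] \<open>c \<noteq> 0\<close> by (simp add: in_keys_iff lookup_monomial_mult)
  then show "Poly_Mapping.single u c * f \<noteq> 0" by auto
  show "LT \<sigma> (Poly_Mapping.single u c * f) = u + LT \<sigma> f"
  proof (rule LT_eqI[OF ord key])
    fix s assume "s \<in> Poly_Mapping.keys (Poly_Mapping.single u c * f)"
    then obtain b where b: "b \<in> Poly_Mapping.keys f" "s = u + b"
      using keys_mult[of "Poly_Mapping.single u c" f] by (auto split: if_splits)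
    then show "(s, u + LT \<sigma> f) \<in> \<sigma>"
      using LT_greatest[OF ord f] term_orderingD(7)[OF ord _ u, of b "LT \<sigma> f"]
      by (simp add: add.commute)
  qed
qed


section \<open>Ideals of polynomial rings\<close>

lemma carrier_poly_ring: "carrier (poly_ring X) = {f. Poly_Mapping.keys f \<subseteq> pps X}"
  by (simp add: poly_ring_def)

lemma carrier_mono: "Y \<subseteq> X \<Longrightarrow> carrier (poly_ring Y) \<subseteq> carrier (poly_ring X)"
  using pps_mono[of Y X] by (auto simp: carrier_poly_ring)

lemma ideal_poly_ringD:
  assumes "ideal I (poly_ring X)"
  shows "I \<subseteq> carrier (poly_ring X)" "0 \<in> I" "\<And>f g. f \<in> I \<Longrightarrow> g \<in> I \<Longrightarrow> f + g \<in> I"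
    "\<And>f p. f \<in> I \<Longrightarrow> p \<in> carrier (poly_ring X) \<Longrightarrow> p * f \<in> I"
    "\<And>f g. f \<in> I \<Longrightarrow> g \<in> I \<Longrightarrow> f - g \<in> I"
proof -
  interpret ideal I "poly_ring X" by fact
  show sub: "I \<subseteq> carrier (poly_ring X)" using a_subset .
  show "0 \<in> I" using additive_subgroup.zero_closed[OF is_additive_subgroup] by (simp add: poly_ring_def)
  show add: "f + g \<in> I" if "f \<in> I" "g \<in> I" for f g
    using additive_subgroup.a_closed[OF is_additive_subgroup that] by (simp add: poly_ring_def)
  show mult: "p * f \<in> I" if "f \<in> I" "p \<in> carrier (poly_ring X)" for f p
    using I_l_closed[OF that] by (simp add: poly_ring_def)
  show "f - g \<in> I" if "f \<in> I" "g \<in> I" for f g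
  proof -
    have "- 1 \<in> carrier (poly_ring X)"
      by (simp add: carrier_poly_ring zero_in_pps)
    from mult[OF that(2) this] add[OF that(1)] show ?thesis by fastforce
  qed
qed

lemma ideal_poly_ringI:
  fixes J :: "'k::field mpoly set"
  assumes sub: "J \<subseteq> carrier (poly_ring X)" and "0 \<in> J"
    and add: "\<And>f g. f \<in> J \<Longrightarrow> g \<in> J \<Longrightarrow> f + g \<in> J"
    and mult: "\<And>f p. f \<in> J \<Longrightarrow> p \<in> carrier (poly_ring X) \<Longrightarrow> p * f \<in> J"
  shows "ideal J (poly_ring X)"
proof (rule idealI)
  interpret cring "poly_ring X :: 'k mpoly ring" by (rule poly_ring_cring)
  show "ring (poly_ring X :: 'k mpoly ring)" by (rule ring_axioms)
  show "subgroup J (add_monoid (poly_ring X))"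
  proof (rule add.subgroupI)
    fix f assume f: "f \<in> J"
    have "- 1 \<in> carrier (poly_ring X :: 'k mpoly ring)"
      by (simp add: carrier_poly_ring zero_in_pps)
    from mult[OF f this] have "- f \<in> J" by simp
    moreover have "\<ominus>\<^bsub>poly_ring X\<^esub> f = - f"
      using f sub \<open>- f \<in> J\<close> by (intro minus_equality) (auto simp: poly_ring_def)
    ultimately show "\<ominus>\<^bsub>poly_ring X\<^esub> f \<in> J" by simp
  qed (use assms in \<open>auto simp: poly_ring_def\<close>)
  show "p \<otimes>\<^bsub>poly_ring X\<^esub> f \<in> J" "f \<otimes>\<^bsub>poly_ring X\<^esub> p \<in> J"
    if "f \<in> J" "p \<in> carrier (poly_ring X)" for f p
    using mult[OF that] by (simp_all add: poly_ring_def mult.commute)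
qed

lemma ideal_contraction:
  fixes I :: "'k::field mpoly set"
  assumes "ideal I (poly_ring X)" "Y \<subseteq> X"
  shows "ideal (I \<inter> carrier (poly_ring Y)) (poly_ring Y)"
proof -
  interpret Y: cring "poly_ring Y :: 'k mpoly ring" by (rule poly_ring_cring)
  note closed = Y.a_closed Y.m_closed Y.zero_closed
  show ?thesis
    using ideal_poly_ringD[OF assms(1)] carrier_mono[OF assms(2)] closed
    by (intro ideal_poly_ringI) (auto simp: poly_ring_def)
qed

text \<open>Membership of a power product in a monomial ideal amounts to divisibility by a generator.\<close>

lemma pp_poly_in_Idl_iff:
  fixes S :: "pp set"
  assumes S: "S \<subseteq> pps X" and t: "t \<in> pps X"
  shows "(pp_poly t :: 'k::field mpoly) \<in> Idl\<^bsub>poly_ring X\<^esub> (pp_poly ` S) \<longleftrightarrow>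
    (\<exists>s \<in> S. \<exists>u. t = s + u)"
proof
  interpret cring "poly_ring X :: 'k mpoly ring" by (rule poly_ring_cring)
  have gens: "pp_poly ` S \<subseteq> carrier (poly_ring X :: 'k mpoly ring)"
    using S by (auto simp: carrier_poly_ring pp_poly_def)
  define J :: "'k mpoly set" where
    "J = {f \<in> carrier (poly_ring X). \<forall>t \<in> Poly_Mapping.keys f. \<exists>s \<in> S. \<exists>u. t = s + u}"
  have "ideal J (poly_ring X)"
  proof (rule ideal_poly_ringI)
    fix f g assume "f \<in> J" "g \<in> J"
    then show "f + g \<in> J"
      using a_closed[of f g] Poly_Mapping.keys_add[of f g] by (auto simp: J_def poly_ring_def)
  next
    fix f p :: "'k mpoly" assume f: "f \<in> J" and p: "p \<in> carrier (poly_ring X)"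
    have "\<exists>s \<in> S. \<exists>u. t = s + u" if t: "t \<in> Poly_Mapping.keys (p * f)" for t
    proof -
      obtain a b where "t = a + b" "b \<in> Poly_Mapping.keys f"
        using t keys_mult[of p f] by auto
      with f show ?thesis unfolding J_def by (auto; metis add.left_commute)
    qed
    with f p m_closed[of p f] show "p * f \<in> J" by (auto simp: J_def poly_ring_def)
  qed (auto simp: J_def carrier_poly_ring)
  moreover have "pp_poly ` S \<subseteq> J"
    using gens by (auto simp: J_def pp_poly_def) (metis add.right_neutral)
  ultimately have "Idl\<^bsub>poly_ring X\<^esub> (pp_poly ` S) \<subseteq> J" by (rule genideal_minimal)
  moreover assume "(pp_poly t :: 'k mpoly) \<in> Idl\<^bsub>poly_ring X\<^esub> (pp_poly ` S)"
  ultimately show "\<exists>s \<in> S. \<exists>u. t = s + u" by (auto simp: J_def pp_poly_def)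
next
  interpret cring "poly_ring X :: 'k mpoly ring" by (rule poly_ring_cring)
  have gens: "pp_poly ` S \<subseteq> carrier (poly_ring X :: 'k mpoly ring)"
    using S by (auto simp: carrier_poly_ring pp_poly_def)
  assume "\<exists>s \<in> S. \<exists>u. t = s + u"
  then obtain s u where s: "s \<in> S" and tu: "t = s + u" by blast
  have "(pp_poly u :: 'k mpoly) \<in> carrier (poly_ring X)"
    using t by (auto simp: carrier_poly_ring pp_poly_def tu pps_add_iff)
  then have "(pp_poly u * pp_poly s :: 'k mpoly) \<in> Idl\<^bsub>poly_ring X\<^esub> (pp_poly ` S)"
    using genideal_self[OF gens] s by (intro ideal_poly_ringD(4)[OF genideal_ideal[OF gens]]) auto
  then show "(pp_poly t :: 'k mpoly) \<in> Idl\<^bsub>poly_ring X\<^esub> (pp_poly ` S)"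
    by (simp add: pp_poly_def tu mult_single add.commute)
qed


section \<open>Groebner bases and normal forms\<close>

text \<open>Equality of the leading term ideals, expressed by divisibility of leading terms.\<close>

lemma groebner_basis_iff:
  fixes I :: "'k::field mpoly set"
  assumes ord: "term_ordering X \<sigma>" and I: "I \<subseteq> carrier (poly_ring X)"
  shows "groebner_basis X \<sigma> I G \<longleftrightarrow>
    finite G \<and> G \<subseteq> I - {0} \<and> (\<forall>f \<in> I - {0}. \<exists>g \<in> G. \<exists>u. LT \<sigma> f = LT \<sigma> g + u)"
proof -
  interpret cring "poly_ring X :: 'k mpoly ring" by (rule poly_ring_cring)
  have LT: "LT \<sigma> f \<in> pps X" if "f \<in> I - {0}" for f
    using that I by (intro LT_in_pps[OF ord]) (auto simp: carrier_poly_ring)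
  have "LT_ideal X \<sigma> I = LT_ideal X \<sigma> G \<longleftrightarrow>
    (\<forall>f \<in> I - {0}. \<exists>g \<in> G. \<exists>u. LT \<sigma> f = LT \<sigma> g + u)" if G: "G \<subseteq> I - {0}"
  proof -
    have gens: "(\<lambda>f. pp_poly (LT \<sigma> f)) ` (I - {0}) \<subseteq> carrier (poly_ring X :: 'k mpoly ring)"
      using LT by (auto simp: carrier_poly_ring pp_poly_def)
    moreover have "G - {0} = G" using G by blast
    ultimately have gensG: "(\<lambda>f. pp_poly (LT \<sigma> f)) ` G \<subseteq> carrier (poly_ring X :: 'k mpoly ring)"
      using G by blast
    have idl: "ideal (LT_ideal X \<sigma> G) (poly_ring X)"
      unfolding LT_ideal_def \<open>G - {0} = G\<close> by (rule genideal_ideal[OF gensG])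
    have "LT_ideal X \<sigma> G \<subseteq> LT_ideal X \<sigma> I"
      unfolding LT_ideal_def using gens G by (intro subset_Idl_subset) auto
    then have "LT_ideal X \<sigma> I = LT_ideal X \<sigma> G \<longleftrightarrow> LT_ideal X \<sigma> I \<subseteq> LT_ideal X \<sigma> G"
      by blast
    also have "\<dots> \<longleftrightarrow> (\<lambda>f. pp_poly (LT \<sigma> f)) ` (I - {0}) \<subseteq> LT_ideal X \<sigma> G"
      using Idl_subset_ideal[OF idl gens] by (simp add: LT_ideal_def)
    also have "\<dots> \<longleftrightarrow> (\<forall>f \<in> I - {0}. pp_poly (LT \<sigma> f) \<in>
        Idl\<^bsub>poly_ring X\<^esub> (pp_poly ` LT \<sigma> ` G :: 'k mpoly set))"
      by (auto simp: LT_ideal_def \<open>G - {0} = G\<close> image_image)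
    also have "\<dots> \<longleftrightarrow> (\<forall>f \<in> I - {0}. \<exists>g \<in> G. \<exists>u. LT \<sigma> f = LT \<sigma> g + u)"
      using G LT by (intro ball_cong refl, subst pp_poly_in_Idl_iff) auto
    finally show ?thesis .
  qed
  then show ?thesis by (auto simp: groebner_basis_def)
qed

text \<open>Division with remainder by an ideal: every polynomial is congruent modulo \<open>J\<close> to one
  whose support avoids all leading terms of elements of \<open>J\<close>.\<close>

lemma normal_form_exists:
  fixes f :: "'k::field mpoly"
  assumes ord: "term_ordering Y \<tau>" and J: "ideal J (poly_ring Y)"
    and f: "f \<in> carrier (poly_ring Y)"
  shows "\<exists>r \<in> carrier (poly_ring Y). f - r \<in> J \<and> Poly_Mapping.keys r \<inter> LT \<tau> ` (J - {0}) = {}"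
proof (cases "f = 0")
  case True
  with ideal_poly_ringD(2)[OF J] show ?thesis by (intro bexI[of _ 0]) (auto simp: carrier_poly_ring)
next
  case False
  interpret cring "poly_ring Y :: 'k mpoly ring" by (rule poly_ring_cring)
  note JD = ideal_poly_ringD[OF J]
  have minus_closed: "p - q \<in> carrier (poly_ring Y)"
    if "p \<in> carrier (poly_ring Y)" "q \<in> carrier (poly_ring Y)" for p q :: "'k mpoly"
    using that keys_diff[of p q] by (auto simp: carrier_poly_ring)
  have "\<forall>f. f \<noteq> 0 \<longrightarrow> f \<in> carrier (poly_ring Y) \<longrightarrow> LT \<tau> f = t \<longrightarrow>
    (\<exists>r \<in> carrier (poly_ring Y). f - r \<in> J \<and> Poly_Mapping.keys r \<inter> LT \<tau> ` (J - {0}) = {})" for t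
  proof (induction t rule: wf_induct[OF term_orderingD(6)[OF ord]])
    case (1 t)
    show ?case
    proof (intro allI impI)
      fix f :: "'k mpoly"
      assume "f \<noteq> 0" and f: "f \<in> carrier (poly_ring Y)" and t: "LT \<tau> f = t"
      note LTf = LT_greatest[OF ord \<open>f \<noteq> 0\<close> f[unfolded carrier_poly_ring mem_Collect_eq], unfolded t]
      have "t \<in> pps Y" using LTf f by (auto simp: carrier_poly_ring)
      \<comment> \<open>the leading monomial is either cancelled by \<open>q\<close> or moved to the remainder \<open>r0\<close>\<close>
      obtain q r0 where q: "q \<in> J" "\<forall>s \<in> Poly_Mapping.keys q. (s, t) \<in> \<tau>"
        and r0: "Poly_Mapping.keys r0 \<subseteq> {t}" "Poly_Mapping.keys r0 \<inter> LT \<tau> ` (J - {0}) = {}"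
        and c: "Poly_Mapping.lookup q t + Poly_Mapping.lookup r0 t = Poly_Mapping.lookup f t"
      proof (cases "t \<in> LT \<tau> ` (J - {0})")
        case True
        then obtain g where g: "g \<in> J" "g \<noteq> 0" "LT \<tau> g = t" by blast
        then have gk: "Poly_Mapping.keys g \<subseteq> pps Y" using JD(1) by (auto simp: carrier_poly_ring)
        note LTg = LT_greatest[OF ord g(2) gk, unfolded g(3)]
        define a where "a = Poly_Mapping.lookup f t / Poly_Mapping.lookup g t"
        have look: "Poly_Mapping.lookup (Poly_Mapping.single 0 a * g) s = a * Poly_Mapping.lookup g s" for s
          using lookup_monomial_mult[of 0 a g s] by simp
        have "a * Poly_Mapping.lookup g t = Poly_Mapping.lookup f t"
          using LTg by (simp add: a_def in_keys_iff)
        show ?thesis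
        proof (rule that[of "Poly_Mapping.single 0 a * g" 0])
          show "Poly_Mapping.single 0 a * g \<in> J"
            using g(1) by (intro JD(4)) (auto simp: carrier_poly_ring zero_in_pps)
          show "\<forall>s \<in> Poly_Mapping.keys (Poly_Mapping.single 0 a * g). (s, t) \<in> \<tau>"
            using LTg by (auto simp: in_keys_iff look)
        qed (use \<open>a * _ = _\<close> in \<open>auto simp: look\<close>)
      next
        case False
        then show ?thesis
          using JD(2) by (intro that[of 0 "Poly_Mapping.single t (Poly_Mapping.lookup f t)"]) auto
      qed
      have r0c: "r0 \<in> carrier (poly_ring Y)"
        using r0(1) \<open>t \<in> pps Y\<close> by (auto simp: carrier_poly_ring)
      define f' where "f' = f - q - r0"
      have f': "f' \<in> carrier (poly_ring Y)"
        unfolding f'_def using f q(1) JD(1) r0c by (auto intro!: minus_closed)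
      have notin: "t \<notin> Poly_Mapping.keys f'"
        using c by (simp add: f'_def in_keys_iff lookup_minus lookup_add diff_diff_eq)
      have below: "(s, t) \<in> \<tau>" if "s \<in> Poly_Mapping.keys f'" for s
      proof -
        have "s \<in> Poly_Mapping.keys f \<union> Poly_Mapping.keys q \<union> Poly_Mapping.keys r0"
          using that keys_diff[of "f - q" r0] keys_diff[of f q] by (auto simp: f'_def)
        then show ?thesis
          using LTf q(2) r0(1) term_orderingD(2)[OF ord \<open>t \<in> pps Y\<close>] by auto
      qed
      have "\<exists>r \<in> carrier (poly_ring Y). f' - r \<in> J \<and>
          Poly_Mapping.keys r \<inter> LT \<tau> ` (J - {0}) = {}"
      proof (cases "f' = 0")
        case True
        with JD(2) show ?thesis by (intro bexI[of _ 0]) (auto simp: carrier_poly_ring)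
      next
        case False
        have "LT \<tau> f' \<in> Poly_Mapping.keys f'"
          using LT_greatest[OF ord False] f' by (simp add: carrier_poly_ring)
        with notin below have "(LT \<tau> f', t) \<in> \<tau> - Id" by auto
        with 1 False f' show ?thesis by blast
      qed
      then obtain r where r: "r \<in> carrier (poly_ring Y)" "f' - r \<in> J"
        "Poly_Mapping.keys r \<inter> LT \<tau> ` (J - {0}) = {}" by blast
      show "\<exists>r \<in> carrier (poly_ring Y). f - r \<in> J \<and>
          Poly_Mapping.keys r \<inter> LT \<tau> ` (J - {0}) = {}"
      proof (intro bexI conjI)
        have "f - (r + r0) = (f' - r) + q" by (simp add: f'_def algebra_simps)
        then show "f - (r + r0) \<in> J" using JD(3)[OF r(2) q(1)] by (simp only:)
        show "Poly_Mapping.keys (r + r0) \<inter> LT \<tau> ` (J - {0}) = {}"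
          using r(3) r0(2) Poly_Mapping.keys_add[of r r0] by blast
        show "r + r0 \<in> carrier (poly_ring Y)"
          using a_closed[OF r(1) r0c] by (simp add: poly_ring_def)
      qed
    qed
  qed
  with f False show ?thesis by blast
qed


section \<open>Elimination orderings\<close>

text \<open>The product ordering that compares the \<open>A\<close>-parts by \<open>\<sigma>\<close> and breaks ties by
  comparing the \<open>(X - A)\<close>-parts by \<open>\<tau>\<close>. The first comparison may use any term
  ordering on \<open>X\<close>, because the \<open>A\<close>-parts are power products in \<open>X\<close>.\<close>

definition elim_ordering :: "nat set \<Rightarrow> nat set \<Rightarrow> pp rel \<Rightarrow> pp rel \<Rightarrow> pp rel"
  where "elim_ordering X A \<sigma> \<tau> = {(s, t). s \<in> pps X \<and> t \<in> pps X \<and>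
    (if restrict_pp A s = restrict_pp A t then (restrict_pp (X - A) s, restrict_pp (X - A) t) \<in> \<tau>
     else (restrict_pp A s, restrict_pp A t) \<in> \<sigma>)}"

lemma term_ordering_elim:
  assumes \<sigma>: "term_ordering X \<sigma>" and \<tau>: "term_ordering (X - A) \<tau>"
  shows "term_ordering X (elim_ordering X A \<sigma> \<tau>)" (is "term_ordering X ?\<rho>")
proof (rule term_orderingI)
  let ?a = "restrict_pp A" and ?b = "restrict_pp (X - A)"
  note S = term_orderingD[OF \<sigma>] and T = term_orderingD[OF \<tau>]
  have a: "?a t \<in> pps X" and b: "?b t \<in> pps (X - A)" if "t \<in> pps X" for t
    using that by (auto simp: pps_def keys_restrict_pp)
  have eq: "s = t" if "s \<in> pps X" "t \<in> pps X" "?a s = ?a t" "?b s = ?b t" for s t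
    using that restrict_pp_split[of s X A] restrict_pp_split[of t X A] by metis
  show "?\<rho> \<subseteq> pps X \<times> pps X" by (auto simp: elim_ordering_def)
  show "(t, t) \<in> ?\<rho>" if "t \<in> pps X" for t
    using that T(2)[OF b] by (simp add: elim_ordering_def)
  show "trans ?\<rho>"
  proof (rule transI)
    fix s t u assume st: "(s, t) \<in> ?\<rho>" and tu: "(t, u) \<in> ?\<rho>"
    consider "?a s = ?a t" "?a t = ?a u" | "(?a s = ?a t) \<noteq> (?a t = ?a u)"
      | "?a s \<noteq> ?a t" "?a t \<noteq> ?a u" by blast
    then show "(s, u) \<in> ?\<rho>"
    proof cases
      case 1
      with st tu show ?thesis
        using transD[OF T(3), of "?b s" "?b t" "?b u"] by (simp add: elim_ordering_def)
    next
      case 2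
      then show ?thesis
      proof (cases "?a s = ?a t")
        case True
        with 2 st tu show ?thesis by (simp add: elim_ordering_def)
      next
        case False
        with 2 have "?a t = ?a u" by blast
        with False st tu show ?thesis by (simp add: elim_ordering_def)
      qed
    next
      case 3
      with st tu have le: "(?a s, ?a t) \<in> \<sigma>" "(?a t, ?a u) \<in> \<sigma>"
        by (simp_all add: elim_ordering_def)
      then have "?a s \<noteq> ?a u" using 3 antisymD[OF S(4)] by metis
      with transD[OF S(3) le] st tu show ?thesis by (simp add: elim_ordering_def)
    qed
  qed
  show "antisym ?\<rho>"
  proof (rule antisymI)
    fix s t assume st: "(s, t) \<in> ?\<rho>" "(t, s) \<in> ?\<rho>"
    have "?a s = ?a t"
    proof (rule ccontr)
      assume ne: "?a s \<noteq> ?a t"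
      with st have "(?a s, ?a t) \<in> \<sigma>" "(?a t, ?a s) \<in> \<sigma>"
        using not_sym[OF ne] by (simp_all add: elim_ordering_def)
      then have "?a s = ?a t" by (rule antisymD[OF S(4)])
      with ne show False ..
    qed
    with st have "(?b s, ?b t) \<in> \<tau>" "(?b t, ?b s) \<in> \<tau>" and "s \<in> pps X" "t \<in> pps X"
      by (simp_all add: elim_ordering_def)
    with \<open>?a s = ?a t\<close> show "s = t" using antisymD[OF T(4)] eq by metis
  qed
  show "(s, t) \<in> ?\<rho> \<or> (t, s) \<in> ?\<rho>" if "s \<in> pps X" "t \<in> pps X" for s t
    using that S(5)[OF a a, of s t] T(5)[OF b b, of s t] by (auto simp: elim_ordering_def)
  show "wf (?\<rho> - Id)"
  proof (rule wf_subset)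
    show "wf (inv_image ((\<sigma> - Id) <*lex*> (\<tau> - Id)) (\<lambda>t. (?a t, ?b t)))"
      by (intro wf_inv_image wf_lex_prod S(6) T(6))
    show "?\<rho> - Id \<subseteq> inv_image ((\<sigma> - Id) <*lex*> (\<tau> - Id)) (\<lambda>t. (?a t, ?b t))"
      by (auto simp: elim_ordering_def split: if_splits dest: eq)
  qed
  show "(s + u, t + u) \<in> ?\<rho>" if "(s, t) \<in> ?\<rho>" "u \<in> pps X" for s t u
    using that S(7)[OF _ a, of "?a s" "?a t" u] T(7)[OF _ b, of "?b s" "?b t" u]
    by (auto simp: elim_ordering_def restrict_pp_add pps_add split: if_splits)
qed

lemma elim_ordering_extends:
  assumes "s \<in> pps (X - A)" "t \<in> pps (X - A)"
  shows "(s, t) \<in> elim_ordering X A \<sigma> \<tau> \<longleftrightarrow> (s, t) \<in> \<tau>"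
proof -
  have "restrict_pp A s = 0" "restrict_pp A t = 0"
    using assms by (auto simp: restrict_pp_eq_0_iff pps_def)
  then show ?thesis
    using assms pps_mono[of "X - A" X] by (auto simp: elim_ordering_def restrict_pp_ident)
qed

text \<open>The elimination property: a polynomial whose leading term is free of \<open>A\<close> is itself
  free of \<open>A\<close>.\<close>

lemma elim_ordering_eliminates:
  assumes \<sigma>: "term_ordering X \<sigma>" and le: "(s, t) \<in> elim_ordering X A \<sigma> \<tau>"
    and t: "t \<in> pps (X - A)"
  shows "s \<in> pps (X - A)"
proof -
  have s: "s \<in> pps X" using le by (simp add: elim_ordering_def)
  have t0: "restrict_pp A t = 0" using t by (auto simp: restrict_pp_eq_0_iff pps_def)
  have "restrict_pp A s \<in> pps X" using s by (auto simp: pps_def keys_restrict_pp)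
  from zero_least[OF \<sigma> this] have "restrict_pp A s = 0"
    using le t0 antisymD[OF term_orderingD(4)[OF \<sigma>], of "restrict_pp A s" 0]
    by (auto simp: elim_ordering_def split: if_splits)
  with s show ?thesis by (auto simp: restrict_pp_eq_0_iff pps_def)
qed

lemma elim_ordering_below_var:
  assumes \<sigma>: "term_ordering X \<sigma>" and s: "s \<in> pps (X - A)" and z: "z \<in> A" "z \<in> X"
  shows "(s, var_pp z) \<in> elim_ordering X A \<sigma> \<tau>"
proof -
  have "restrict_pp A s = 0" using s by (auto simp: restrict_pp_eq_0_iff pps_def)
  moreover have "restrict_pp A (var_pp z) = var_pp z"
    by (rule restrict_pp_ident) (simp add: var_pp_in_pps_iff z)
  moreover have "var_pp z \<noteq> 0" by (metis keys_single keys_zero one_neq_zero insert_not_empty var_pp_def)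
  moreover have "var_pp z \<in> pps X" by (simp add: var_pp_in_pps_iff z)
  ultimately show ?thesis
    using zero_least[OF \<sigma>, of "var_pp z"] s pps_mono[of "X - A" X]
    by (auto simp: elim_ordering_def)
qed

section \<open>The projection of the restricted Groebner fan\<close>

text \<open>If the indeterminates in \<open>A\<close> are leading terms of a reduced basis, then a term of a
  basis element \<open>g\<close> can involve \<open>A\<close> only if it is the leading term of \<open>g\<close> and belongs to
  \<open>A\<close>: a larger multiple of \<open>z\<close> in \<open>g\<close> would exceed that leading term.\<close>

lemma reduced_basis_term:
  fixes I :: "'k::field mpoly set"
  assumes ord: "term_ordering X \<sigma>" and I: "I \<subseteq> carrier (poly_ring X)"
    and G: "reduced_groebner_basis X \<sigma> I G"
    and vars: "\<forall>z \<in> A. var_pp z \<in> LT \<sigma> ` G"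
    and g: "g \<in> G" and t: "t \<in> Poly_Mapping.keys g" and z: "z \<in> A" "z \<in> Poly_Mapping.keys t"
  shows "t = var_pp z" "LT \<sigma> g = var_pp z"
proof -
  obtain u where u: "t = var_pp z + u" using var_pp_dvd[OF z(2)] .
  obtain h where h: "h \<in> G" "LT \<sigma> h = var_pp z" using vars[rule_format, OF z(1)] by auto
  have "h = g"
    using G g h t u unfolding reduced_groebner_basis_def by (metis DiffI singletonD)
  with h show LT: "LT \<sigma> g = var_pp z" by simp
  have g': "g \<noteq> 0" "Poly_Mapping.keys g \<subseteq> pps X"
    using G g I by (auto simp: reduced_groebner_basis_def groebner_basis_def carrier_poly_ring)
  have "(t, var_pp z) \<in> \<sigma>" using LT_greatest[OF ord g'] t LT by simp
  moreover have "t \<in> pps X" using t g' by blast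
  then have "(var_pp z, t) \<in> \<sigma>"
    unfolding u by (intro dvd_imp_le[OF ord]) (simp_all add: pps_add_iff)
  ultimately show "t = var_pp z" using term_orderingD(4)[OF ord] by (auto dest: antisymD)
qed

lemma restricted_GFanE:
  fixes I :: "'k::field mpoly set"
  assumes "M \<in> restricted_GFan X Z I"
  obtains \<sigma> G where "term_ordering X \<sigma>" "reduced_groebner_basis X \<sigma> I G" "M = marked \<sigma> G"
    "\<forall>z \<in> set Z. var_pp z \<in> LT \<sigma> ` G"
  using assms by (auto simp: restricted_GFan_def GFan_def marked_def) blast

lemma GFan_projection_marked:
  "GFan_projection Z (marked \<sigma> G) = marked \<sigma> {g \<in> G. LT \<sigma> g \<notin> var_pp ` set Z}"
  by (auto simp: GFan_projection_def marked_def)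

lemma marked_cong: "(\<And>g. g \<in> G \<Longrightarrow> LT \<sigma> g = LT \<tau> g) \<Longrightarrow> marked \<sigma> G = marked \<tau> G"
  by (simp add: marked_def)

lemma GFan_projection_in_GFan:
  fixes I :: "'k::field mpoly set"
  assumes I: "I \<subseteq> carrier (poly_ring X)" and Y: "Y = X - set Z"
    and M: "M \<in> restricted_GFan X Z I"
  shows "GFan_projection Z M \<in> GFan Y (I \<inter> carrier (poly_ring Y))"
proof -
  obtain \<sigma> G where ord: "term_ordering X \<sigma>" and red: "reduced_groebner_basis X \<sigma> I G"
    and MG: "M = marked \<sigma> G" and vars: "\<forall>z \<in> set Z. var_pp z \<in> LT \<sigma> ` G"
    using restricted_GFanE[OF M] by metis
  note basis_term = reduced_basis_term[OF ord I red vars]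
  define H where "H = {g \<in> G. LT \<sigma> g \<notin> var_pp ` set Z}"
  define \<tau> where "\<tau> = Restr \<sigma> (pps Y)"
  have "Y \<subseteq> X" using Y by auto
  have ord': "term_ordering Y \<tau>" unfolding \<tau>_def by (rule term_ordering_Restr[OF ord \<open>Y \<subseteq> X\<close>])
  have GI: "G \<subseteq> I - {0}" "finite G"
    and GB: "\<And>f. f \<in> I - {0} \<Longrightarrow> \<exists>g \<in> G. \<exists>u. LT \<sigma> f = LT \<sigma> g + u"
    using red by (auto simp: reduced_groebner_basis_def groebner_basis_iff[OF ord I])
  have LTeq: "LT \<tau> f = LT \<sigma> f" if "f \<in> carrier (poly_ring Y)" for f :: "'k mpoly"
    using that by (intro LT_cong[of f "pps Y"]) (auto simp: carrier_poly_ring \<tau>_def)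
  have HY: "h \<in> carrier (poly_ring Y)" if "h \<in> H" for h
    unfolding carrier_poly_ring mem_Collect_eq
  proof
    fix t assume t: "t \<in> Poly_Mapping.keys h"
    have "t \<in> pps X" using that t GI I by (auto simp: H_def carrier_poly_ring)
    moreover have "z \<notin> Poly_Mapping.keys t" if "z \<in> set Z" for z
      using basis_term(2)[OF _ t that] \<open>h \<in> H\<close> that by (auto simp: H_def)
    ultimately show "t \<in> pps Y" by (auto simp: pps_def Y)
  qed
  have "reduced_groebner_basis Y \<tau> (I \<inter> carrier (poly_ring Y)) H"
    unfolding reduced_groebner_basis_def
  proof (intro conjI)
    show "groebner_basis Y \<tau> (I \<inter> carrier (poly_ring Y)) H"
      unfolding groebner_basis_iff[OF ord' Int_lower2]
    proof (intro conjI ballI)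
      show "finite H" using GI by (simp add: H_def)
      show "H \<subseteq> I \<inter> carrier (poly_ring Y) - {0}" using GI HY by (auto simp: H_def)
      fix f assume f: "f \<in> I \<inter> carrier (poly_ring Y) - {0}"
      then obtain g u where g: "g \<in> G" "LT \<sigma> f = LT \<sigma> g + u" using GB[of f] by auto
      have "LT \<tau> f \<in> pps Y" using f by (intro LT_in_pps[OF ord']) (auto simp: carrier_poly_ring)
      then have "LT \<sigma> g \<in> pps Y" using f g LTeq[of f] by (auto simp: pps_add_iff)
      then have "g \<in> H" using g by (auto simp: H_def var_pp_in_pps_iff Y)
      with g f LTeq HY show "\<exists>g \<in> H. \<exists>u. LT \<tau> f = LT \<tau> g + u" by auto
    qed
    show "\<forall>g \<in> H. LC \<tau> g = 1"
      using red HY LTeq by (auto simp: reduced_groebner_basis_def LC_def H_def)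
    show "\<forall>g \<in> H. \<forall>h \<in> H - {g}. \<forall>t \<in> Poly_Mapping.keys g. \<nexists>u. t = LT \<tau> h + u"
      using red HY LTeq unfolding reduced_groebner_basis_def H_def by (metis (no_types, lifting) DiffD1 DiffD2 DiffI mem_Collect_eq)
  qed
  moreover have "GFan_projection Z M = marked \<tau> H"
    unfolding MG GFan_projection_marked H_def[symmetric] using HY LTeq by (intro marked_cong) simp
  ultimately show ?thesis using ord' by (auto simp: GFan_def)
qed

text \<open>Two elements marked by the same \<open>z\<close> differ by an element of \<open>I\<close> free of
  \<open>Z\<close>, none of whose terms is divisible by a mark of the common projection, so this difference vanishes.\<close>

lemma GFan_projection_subset:
  fixes I :: "'k::field mpoly set"
  assumes idl: "ideal I (poly_ring X)"
    and M1: "M1 \<in> restricted_GFan X Z I" and M2: "M2 \<in> restricted_GFan X Z I"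
    and eq: "GFan_projection Z M1 = GFan_projection Z M2"
  shows "M1 \<subseteq> M2"
proof -
  note ID = ideal_poly_ringD[OF idl]
  obtain \<sigma>1 G1 where ord1: "term_ordering X \<sigma>1" and red1: "reduced_groebner_basis X \<sigma>1 I G1"
    and MG1: "M1 = marked \<sigma>1 G1" and vars1: "\<forall>z \<in> set Z. var_pp z \<in> LT \<sigma>1 ` G1"
    using restricted_GFanE[OF M1] by metis
  obtain \<sigma>2 G2 where ord2: "term_ordering X \<sigma>2" and red2: "reduced_groebner_basis X \<sigma>2 I G2"
    and MG2: "M2 = marked \<sigma>2 G2" and vars2: "\<forall>z \<in> set Z. var_pp z \<in> LT \<sigma>2 ` G2"
    using restricted_GFanE[OF M2] by metis
  note term1 = reduced_basis_term[OF ord1 ID(1) red1 vars1]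
    and term2 = reduced_basis_term[OF ord2 ID(1) red2 vars2]
  have GI: "G1 \<subseteq> I" "G2 \<subseteq> I"
    using red1 red2 by (auto simp: reduced_groebner_basis_def groebner_basis_def)
  have "(LT \<sigma>1 g, g) \<in> M2" if g: "g \<in> G1" for g
  proof (cases "LT \<sigma>1 g \<in> var_pp ` set Z")
    case False
    then have "(LT \<sigma>1 g, g) \<in> GFan_projection Z M1"
      using g by (auto simp: GFan_projection_def MG1 marked_def)
    with eq show ?thesis by (auto simp: GFan_projection_def)
  next
    case True
    then obtain z where z: "z \<in> set Z" "LT \<sigma>1 g = var_pp z" by auto
    obtain g' where g': "g' \<in> G2" "LT \<sigma>2 g' = var_pp z" using vars2[rule_format, OF z(1)] by auto
    define d where "d = g - g'"
    have d: "d \<in> I" using ID(5) GI g g' by (auto simp: d_def)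
    have "d = 0"
    proof (rule ccontr)
      assume "d \<noteq> 0"
      have dX: "Poly_Mapping.keys d \<subseteq> pps X" using d ID(1) by (auto simp: carrier_poly_ring)
      define t where "t = LT \<sigma>1 d"
      have t: "t \<in> Poly_Mapping.keys d"
        using LT_greatest[OF ord1 \<open>d \<noteq> 0\<close> dX] by (simp add: t_def)
      then have t': "t \<in> Poly_Mapping.keys g \<or> t \<in> Poly_Mapping.keys g'"
        using keys_diff[of g g'] by (auto simp: d_def)
      \<comment> \<open>both coefficients of \<open>z\<close> are 1\<close>
      have "Poly_Mapping.lookup g (var_pp z) = 1" "Poly_Mapping.lookup g' (var_pp z) = 1"
        using red1 red2 g g' z by (auto simp: reduced_groebner_basis_def LC_def)
      then have "var_pp z \<notin> Poly_Mapping.keys d" by (simp add: d_def in_keys_iff lookup_minus)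
      then have tz: "t \<noteq> var_pp z" using t by blast
      have free: "w \<notin> Poly_Mapping.keys t" if w: "w \<in> set Z" for w
        using t' tz term1[OF g _ w] term2[OF g'(1) _ w] z(2) g'(2) by metis
      obtain h u where h: "h \<in> G1" "t = LT \<sigma>1 h + u"
        using red1 d \<open>d \<noteq> 0\<close>
        unfolding reduced_groebner_basis_def groebner_basis_iff[OF ord1 ID(1)] t_def by blast
      have nz: "LT \<sigma>1 h \<notin> var_pp ` set Z"
      proof
        assume "LT \<sigma>1 h \<in> var_pp ` set Z"
        then obtain w where w: "w \<in> set Z" "t = var_pp w + u" using h(2) by auto
        then have "w \<in> Poly_Mapping.keys t" by (simp add: keys_add_pp var_pp_def)
        with free[OF w(1)] show False by blast
      qed
      then have "(LT \<sigma>1 h, h) \<in> GFan_projection Z M1"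
        using h by (auto simp: GFan_projection_def MG1 marked_def)
      then have h2: "h \<in> G2" "LT \<sigma>2 h = LT \<sigma>1 h"
        unfolding eq by (auto simp: GFan_projection_def MG2 marked_def)
      have "h \<noteq> g" "h \<noteq> g'" using nz z g' h2 by auto
      then show False
        using t' red1 red2 g g'(1) h h2 unfolding reduced_groebner_basis_def
        by (metis DiffI singletonD)
    qed
    then have "g = g'" by (simp add: d_def)
    have "(LT \<sigma>2 g', g') \<in> M2" unfolding MG2 marked_def using g'(1) by (rule imageI)
    with \<open>g = g'\<close> g'(2) z(2) show ?thesis by metis
  qed
  then show ?thesis by (auto simp: MG1 marked_def)
qed

text \<open>Every point of the fan of \<open>I \<inter> K[Y]\<close> is attained, by a basis for an elimination
  ordering that compares the \<open>Z\<close>-parts as in an arbitrary point of the restricted fan.\<close>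

lemma GFan_projection_surj:
  fixes I :: "'k::field mpoly set"
  assumes idl: "ideal I (poly_ring X)" and ZX: "set Z \<subseteq> X" and Y: "Y = X - set Z"
    and ne: "restricted_GFan X Z I \<noteq> {}"
    and N: "N \<in> GFan Y (I \<inter> carrier (poly_ring Y))"
  shows "\<exists>M \<in> restricted_GFan X Z I. GFan_projection Z M = N"
proof -
  note ID = ideal_poly_ringD[OF idl]
  obtain M0 where M0: "M0 \<in> restricted_GFan X Z I" using ne by blast
  obtain \<sigma> G0 where ord: "term_ordering X \<sigma>" and red: "reduced_groebner_basis X \<sigma> I G0"
    and vars: "\<forall>z \<in> set Z. var_pp z \<in> LT \<sigma> ` G0"
    using restricted_GFanE[OF M0] by metis
  note basis_term = reduced_basis_term[OF ord ID(1) red vars]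
  have G0I: "G0 \<subseteq> I - {0}"
    and GB0: "\<And>f. f \<in> I - {0} \<Longrightarrow> \<exists>g \<in> G0. \<exists>u. LT \<sigma> f = LT \<sigma> g + u"
    using red by (auto simp: reduced_groebner_basis_def groebner_basis_iff[OF ord ID(1)])
  define J where "J = I \<inter> carrier (poly_ring Y)"
  have "Y \<subseteq> X" using Y by auto
  have J: "ideal J (poly_ring Y)" unfolding J_def by (rule ideal_contraction[OF idl \<open>Y \<subseteq> X\<close>])
  note JD = ideal_poly_ringD[OF J]
  obtain \<tau> H where \<tau>: "term_ordering Y \<tau>" and redH: "reduced_groebner_basis Y \<tau> J H"
    and NH: "N = marked \<tau> H"
    using N by (auto simp: GFan_def J_def)
  have HJ: "finite H" "H \<subseteq> J - {0}"
    and GBH: "\<And>f. f \<in> J - {0} \<Longrightarrow> \<exists>g \<in> H. \<exists>u. LT \<tau> f = LT \<tau> g + u"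
    using redH by (auto simp: reduced_groebner_basis_def groebner_basis_iff[OF \<tau> JD(1)])
  have HY: "Poly_Mapping.keys h \<subseteq> pps Y" "h \<noteq> 0" if "h \<in> H" for h
    using that HJ by (auto simp: J_def carrier_poly_ring)
  define \<rho> where "\<rho> = elim_ordering X (set Z) \<sigma> \<tau>"
  have \<rho>: "term_ordering X \<rho>"
    unfolding \<rho>_def using ord \<tau> Y by (intro term_ordering_elim) auto
  have LTeq: "LT \<rho> f = LT \<tau> f" if "Poly_Mapping.keys f \<subseteq> pps Y" for f :: "'k mpoly"
    using that by (intro LT_cong[of f "pps Y"]) (auto simp: \<rho>_def Y elim_ordering_extends)

  \<comment> \<open>reduce the tails of the given linear forms modulo \<open>J\<close>\<close>
  have "\<exists>r. r \<in> carrier (poly_ring Y) \<and> pp_poly (var_pp z) - r \<in> I \<and>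
      Poly_Mapping.keys r \<inter> LT \<tau> ` (J - {0}) = {}" if z: "z \<in> set Z" for z
  proof -
    obtain g where g: "g \<in> G0" "LT \<sigma> g = var_pp z" using vars[rule_format, OF z] by auto
    define f where "f = pp_poly (var_pp z) - g"
    have "Poly_Mapping.lookup g (var_pp z) = 1"
      using red g by (auto simp: reduced_groebner_basis_def LC_def)
    then have nk: "var_pp z \<notin> Poly_Mapping.keys f"
      by (simp add: f_def pp_poly_def in_keys_iff lookup_minus)
    have "f \<in> carrier (poly_ring Y)"
      unfolding carrier_poly_ring mem_Collect_eq
    proof
      fix t assume t: "t \<in> Poly_Mapping.keys f"
      then have t': "t \<in> Poly_Mapping.keys g" and tz: "t \<noteq> var_pp z"
        using nk keys_diff[of "pp_poly (var_pp z)" g] by (auto simp: f_def pp_poly_def)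
      have "t \<in> pps X" using t' g G0I ID(1) by (auto simp: carrier_poly_ring)
      moreover have "w \<notin> Poly_Mapping.keys t" if w: "w \<in> set Z" for w
        using basis_term[OF g(1) t' w] tz g(2) by metis
      ultimately show "t \<in> pps Y" by (auto simp: pps_def Y)
    qed
    from normal_form_exists[OF \<tau> J this] obtain r where r: "r \<in> carrier (poly_ring Y)"
      "f - r \<in> J" "Poly_Mapping.keys r \<inter> LT \<tau> ` (J - {0}) = {}" by blast
    have "g + (f - r) \<in> I" using ID(3) r(2) g G0I by (auto simp: J_def)
    with r show ?thesis by (auto simp: f_def)
  qed
  then obtain r where r: "\<And>z. z \<in> set Z \<Longrightarrow> r z \<in> carrier (poly_ring Y)"
      "\<And>z. z \<in> set Z \<Longrightarrow> pp_poly (var_pp z) - r z \<in> I"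
      "\<And>z. z \<in> set Z \<Longrightarrow> Poly_Mapping.keys (r z) \<inter> LT \<tau> ` (J - {0}) = {}"
    by metis
  define p where "p z = pp_poly (var_pp z) - r z" for z
  define G where "G = p ` set Z \<union> H"
  have zY: "var_pp z \<notin> pps Y" if "z \<in> set Z" for z
    using that by (auto simp: var_pp_in_pps_iff Y)
  have look: "Poly_Mapping.lookup (p z) (var_pp z) = 1" if z: "z \<in> set Z" for z
    using zY[OF z] r(1)[OF z] by (auto simp: p_def pp_poly_def lookup_minus carrier_poly_ring in_keys_iff subset_iff)
  have keysp: "t = var_pp z \<or> t \<in> Poly_Mapping.keys (r z)" if "t \<in> Poly_Mapping.keys (p z)" for t z
    using that keys_diff[of "pp_poly (var_pp z)" "r z"] by (auto simp: p_def pp_poly_def)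
  have rY: "Poly_Mapping.keys (r z) \<subseteq> pps Y" if "z \<in> set Z" for z
    using r(1)[OF that] by (simp add: carrier_poly_ring)
  have LTp: "LT \<rho> (p z) = var_pp z" if z: "z \<in> set Z" for z
  proof (rule LT_eqI[OF \<rho>])
    show "var_pp z \<in> Poly_Mapping.keys (p z)" using look[OF z] by (simp add: in_keys_iff)
    show "(s, var_pp z) \<in> \<rho>" if "s \<in> Poly_Mapping.keys (p z)" for s
      using keysp[OF that]
    proof
      assume "s = var_pp z"
      then show ?thesis using term_orderingD(2)[OF \<rho>] z ZX by (auto simp: var_pp_in_pps_iff)
    next
      assume "s \<in> Poly_Mapping.keys (r z)"
      then show ?thesis
        unfolding \<rho>_def using rY[OF z] z ZX Y by (intro elim_ordering_below_var[OF ord]) auto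
    qed
  qed
  have LTH: "LT \<rho> h = LT \<tau> h" "LT \<tau> h \<in> pps Y" if "h \<in> H" for h
    using LTeq HY[OF that] LT_in_pps[OF \<tau>] by auto
  \<comment> \<open>otherwise \<open>h\<close> is a constant in \<open>I\<close>, and 1 divides the term \<open>z\<close> of the given basis\<close>
  have unit: "LT \<tau> h \<noteq> 0" if h: "h \<in> H" and z: "z \<in> set Z" for h z
  proof
    assume 0: "LT \<tau> h = 0"
    have "t = 0" if "t \<in> Poly_Mapping.keys h" for t
      using LT_greatest[OF \<tau> HY(2,1)[OF h]] that HY[OF h] zero_least[OF \<tau>, of t] term_orderingD(4)[OF \<tau>]
      by (auto simp: 0 dest: antisymD)
    moreover have "LT \<sigma> h \<in> Poly_Mapping.keys h"
      using LT_greatest[OF ord HY(2)[OF h]] HY(1)[OF h] pps_mono[OF \<open>Y \<subseteq> X\<close>] by auto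
    ultimately have "LT \<sigma> h = 0" by blast
    then obtain g u where g: "g \<in> G0" "0 = LT \<sigma> g + u"
      using GB0[of h] h HJ by (auto simp: J_def)
    have "Poly_Mapping.keys (LT \<sigma> g + u) = {}" using g(2) by (metis keys_zero)
    then have "LT \<sigma> g = 0" by (simp add: keys_add_pp keys_eq_empty)
    obtain g1 where g1: "g1 \<in> G0" "LT \<sigma> g1 = var_pp z" using vars[rule_format, OF z] by auto
    have "var_pp z \<noteq> 0" using zY[OF z] zero_in_pps by metis
    then have "g \<noteq> g1" using g1 \<open>LT \<sigma> g = 0\<close> by metis
    moreover have "Poly_Mapping.lookup g1 (var_pp z) = 1"
      using red g1 by (auto simp: reduced_groebner_basis_def LC_def)
    then have "var_pp z \<in> Poly_Mapping.keys g1" by (simp add: in_keys_iff)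
    moreover have "var_pp z = LT \<sigma> g + var_pp z" using \<open>LT \<sigma> g = 0\<close> by simp
    ultimately show False
      using red g(1) g1(1) unfolding reduced_groebner_basis_def by (metis DiffI singletonD)
  qed
  have "reduced_groebner_basis X \<rho> I G"
    unfolding reduced_groebner_basis_def
  proof (intro conjI ballI)
    show "groebner_basis X \<rho> I G"
      unfolding groebner_basis_iff[OF \<rho> ID(1)]
    proof (intro conjI ballI)
      show "finite G" using HJ by (simp add: G_def)
      have "p z \<noteq> 0" if "z \<in> set Z" for z using look[OF that] by auto
      then show "G \<subseteq> I - {0}" using r(2) HJ by (auto simp: G_def p_def J_def)
      fix f assume f: "f \<in> I - {0}"
      then have fX: "f \<noteq> 0" "Poly_Mapping.keys f \<subseteq> pps X"
        using ID(1) by (auto simp: carrier_poly_ring)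
      show "\<exists>g \<in> G. \<exists>u. LT \<rho> f = LT \<rho> g + u"
      proof (cases "LT \<rho> f \<in> pps Y")
        case True
        have fY: "Poly_Mapping.keys f \<subseteq> pps Y"
        proof
          fix s assume "s \<in> Poly_Mapping.keys f"
          then have "(s, LT \<rho> f) \<in> \<rho>" using LT_greatest[OF \<rho> fX] by blast
          then show "s \<in> pps Y"
            using elim_ordering_eliminates[OF ord] True unfolding \<rho>_def Y by blast
        qed
        then have "f \<in> J - {0}" using f by (auto simp: J_def carrier_poly_ring)
        then obtain h u where h: "h \<in> H" "LT \<tau> f = LT \<tau> h + u" using GBH by blast
        then have "LT \<rho> f = LT \<rho> h + u" using LTH(1) LTeq[OF fY] by simp
        with h(1) show ?thesis unfolding G_def by blast
      next
        case False
        then obtain z where z: "z \<in> set Z" "z \<in> Poly_Mapping.keys (LT \<rho> f)"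
          using LT_in_pps[OF \<rho> fX] by (auto simp: pps_def Y)
        obtain u where "LT \<rho> f = var_pp z + u" using var_pp_dvd[OF z(2)] .
        then have "LT \<rho> f = LT \<rho> (p z) + u" using LTp[OF z(1)] by simp
        then show ?thesis using z by (auto simp: G_def)
      qed
    qed
    show "LC \<rho> g = 1" if "g \<in> G" for g
      using that redH LTp look LTH(1) by (auto simp: G_def LC_def reduced_groebner_basis_def)
    fix g h t assume g: "g \<in> G" and h: "h \<in> G - {g}" and t: "t \<in> Poly_Mapping.keys g"
    show "\<nexists>u. t = LT \<rho> h + u"
    proof
      assume "\<exists>u. t = LT \<rho> h + u"
      then obtain u where u: "t = LT \<rho> h + u" by blast
      show False
      proof (cases "h \<in> H")
        case False
        then obtain w where w: "w \<in> set Z" "h = p w" using h by (auto simp: G_def)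
        then have tw: "t = var_pp w + u" using u LTp by simp
        then have "t \<notin> pps Y" using zY[OF w(1)] by (simp add: pps_add_iff)
        with g t HY(1) have "g \<notin> H" by blast
        then obtain z where z: "z \<in> set Z" "g = p z" using g by (auto simp: G_def)
        with \<open>t \<notin> pps Y\<close> keysp[of t z] t rY[OF z(1)] have "t = var_pp z" by auto
        then have "w \<in> Poly_Mapping.keys (var_pp z)"
          using tw by (metis UnI1 insertI1 keys_add_pp keys_single one_neq_zero var_pp_def)
        then have "w = z" by (simp add: var_pp_def)
        with w z h show False by simp
      next
        case hH: True
        have tu: "t = LT \<tau> h + u" using u LTH(1)[OF hH] by simp
        show False
        proof (cases "g \<in> H")
          case True
          then show False
            using redH hH h t tu unfolding reduced_groebner_basis_def by blast
        next
          case False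
          then obtain z where z: "z \<in> set Z" "g = p z" using g by (auto simp: G_def)
          from keysp[of t z] t z have "t = var_pp z \<or> t \<in> Poly_Mapping.keys (r z)" by simp
          then show False
          proof
            assume "t = var_pp z"
            then have "Poly_Mapping.keys (LT \<tau> h) \<subseteq> {z}"
              using tu by (metis keys_add_pp keys_single one_neq_zero sup_ge1 var_pp_def)
            moreover have "z \<notin> Poly_Mapping.keys (LT \<tau> h)"
              using LTH(2)[OF hH] z(1) by (auto simp: pps_def Y)
            ultimately have "Poly_Mapping.keys (LT \<tau> h) = {}" by blast
            then show False using unit[OF hH z(1)] by (simp add: keys_eq_empty)
          next
            assume tr: "t \<in> Poly_Mapping.keys (r z)"
            then have "u \<in> pps Y" using rY[OF z(1)] tu by (auto simp: pps_add_iff)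
            \<comment> \<open>a multiple of \<open>h\<close> in \<open>J\<close> would have the term \<open>t\<close> of a normal form as leading term\<close>
            define q where "q = Poly_Mapping.single u 1 * h"
            have "LT \<tau> q = t" "q \<noteq> 0"
              using LT_monomial_mult[OF \<tau> HY(2,1)[OF hH] \<open>u \<in> pps Y\<close>, of 1] tu
              by (auto simp: q_def add.commute)
            moreover have "q \<in> J"
              unfolding q_def using hH HJ \<open>u \<in> pps Y\<close>
              by (intro JD(4)) (auto simp: carrier_poly_ring)
            ultimately show False using r(3)[OF z(1)] tr by blast
          qed
        qed
      qed
    qed
  qed
  then have "marked \<rho> G \<in> GFan X I" using \<rho> by (auto simp: GFan_def)
  moreover have "(var_pp z, p z) \<in> marked \<rho> G" if "z \<in> set Z" for z
  proof -
    have "(LT \<rho> (p z), p z) \<in> marked \<rho> G"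
      unfolding marked_def G_def using that by (intro imageI UnI1)
    then show ?thesis by (simp only: LTp[OF that])
  qed
  ultimately have "marked \<rho> G \<in> restricted_GFan X Z I"
    unfolding restricted_GFan_def by blast
  moreover have "{g \<in> G. LT \<rho> g \<notin> var_pp ` set Z} = H"
  proof -
    have "LT \<rho> h \<notin> var_pp ` set Z" if "h \<in> H" for h
      using LTH[OF that] zY by fastforce
    moreover have "LT \<rho> g \<in> var_pp ` set Z" if "g \<in> p ` set Z" for g
      using that LTp by fastforce
    ultimately show ?thesis unfolding G_def by blast
  qed
  then have "GFan_projection Z (marked \<rho> G) = N"
    unfolding GFan_projection_marked NH by (simp only:) (intro marked_cong LTH(1))
  ultimately show ?thesis by blast
qed

theorem theorem5p5:
  fixes n :: nat and Z Y :: "nat list" and I :: "'k::field mpoly set"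
  assumes "distinct Z" and "set Z \<subseteq> {1..n}"
    and "distinct Y" and "set Y = {1..n} - set Z"
    and "ideal I (poly_ring {1..n})"
    and "I \<subseteq> irrelevant_ideal {1..n}"
    and "I \<noteq> {0}"
    and "restricted_GFan {1..n} Z I \<noteq> {}"
  shows "bij_betw (GFan_projection Z)
    (restricted_GFan {1..n} Z I) (GFan (set Y) (I \<inter> carrier (poly_ring (set Y))))"
  unfolding bij_betw_def
proof
  show "inj_on (GFan_projection Z) (restricted_GFan {1..n} Z I)"
    by (intro inj_onI subset_antisym)
      (simp_all add: GFan_projection_subset[OF assms(5)])
  show "GFan_projection Z ` restricted_GFan {1..n} Z I =
      GFan (set Y) (I \<inter> carrier (poly_ring (set Y)))"
  proof (intro subset_antisym subsetI)
    fix N assume "N \<in> GFan_projection Z ` restricted_GFan {1..n} Z I"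
    then show "N \<in> GFan (set Y) (I \<inter> carrier (poly_ring (set Y)))"
      using GFan_projection_in_GFan[OF ideal_poly_ringD(1)[OF assms(5)] assms(4)] by auto
  next
    fix N assume "N \<in> GFan (set Y) (I \<inter> carrier (poly_ring (set Y)))"
    from GFan_projection_surj[OF assms(5,2,4,8) this]
    show "N \<in> GFan_projection Z ` restricted_GFan {1..n} Z I" by auto
  qed
qed

end
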